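(* Let $n \ge 2$ and let $A$ be an $n\times n$ row stochastic matrix with eigenvalues $1=\lambda_1, \lambda_2, \ldots, \lambda_n \in \mathbb{C}$, counted with algebraic multiplicity and ordered so that $1=|\lambda_1|\geq |\lambda_2|\geq \cdots \geq |\lambda_n|$. Then $$|\lambda_2| = \lim_{k\to\infty} q(A^k)^{1/k} = \inf_{k\geq 1} q(A^k)^{1/k}.$$
   Context: A real $n\times n$ matrix $B=(b_{ij})$ is row stochastic if $b_{ij}\ge 0$ for all $i,j$ and $\sum_{j=1}^n b_{ij}=1$ for every $1\le i\le n$. For an $n\times n$ row stochastic matrix $B=(b_{ij})$, the number $q(B)$ is $$q(B) = \frac12 \sup_{i,k} \sum_{j=1}^n |b_{ij}-b_{kj}| = 1-\min_{i,k}\sum_{j=1}^n \min(b_{ij},b_{kj}),$$ where $i,k$ range over $\{1,\ldots,n\}$ (the two expressions agree for row stochastic $B$). Powers of a row stochastic matrix are row stochastic, so $q(A^k)$ is defined for all $k\ge 1$. *)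

theory Defs
  imports Complex_Main "Jordan_Normal_Form.Char_Poly"
begin

definition row_stochastic :: "nat \<Rightarrow> real mat \<Rightarrow> bool" where
  "row_stochastic n B \<longleftrightarrow> B \<in> carrier_mat n n \<and>
     (\<forall>i<n. \<forall>j<n. 0 \<le> B $$ (i, j)) \<and> (\<forall>i<n. (\<Sum>j<n. B $$ (i, j)) = 1)"

(* The supremum runs over a finite set of pairs of rows, which is nonempty unless
   B has no rows. *)
definition q :: "real mat \<Rightarrow> real" where
  "q B = 1 / 2 * (SUP (i, k) \<in> {..<dim_row B} \<times> {..<dim_row B}.
                    \<Sum>j<dim_col B. \<bar>B $$ (i, j) - B $$ (k, j)\<bar>)"

(* The entries of es are the complex eigenvalues of the real matrix A, each listed as
   often as its algebraic multiplicity, i.e. its multiplicity as a root of the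
   characteristic polynomial.  Since this polynomial is monic of degree n for an
   n x n matrix, such a list has length n. *)
definition eigenvalue_list :: "real mat \<Rightarrow> complex list \<Rightarrow> bool" where
  "eigenvalue_list A es \<longleftrightarrow>
     char_poly (map_mat complex_of_real A) = (\<Prod>a\<leftarrow>es. [:- a, 1:])"

end

theory Submission
  imports Defs "Jordan_Normal_Form.Spectral_Radius"
begin

text \<open>Subtracting the first row of \<open>A\<close> from all its rows gives a multiplicative map on matrices with
  unit row sums. It removes one eigenvalue 1 and its entries bound, and are bounded by, multiples of
  \<open>q A\<close>. So \<open>q (A ^ k)\<close> grows like the \<open>k\<close>-th power of a matrix \<open>C\<close> with spectral radius
  \<open>\<bar>\<lambda>\<^sub>2\<bar>\<close>. Moreover \<open>\<bar>\<lambda>\<^sub>2\<bar>\<^sup>k \<le> q (A ^ k)\<close> holds for each \<open>k\<close>, because \<open>q\<close> bounds the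
  factor by which a matrix contracts the oscillation of a vector; this yields the infimum.\<close>

section \<open>Deflation of the eigenvalue 1\<close>

text \<open>For a matrix with unit row sums, this is the matrix of the induced map on the quotient
  by the line of the all-ones vector, in the basis given by the classes of the last \<open>m\<close>
  unit vectors.\<close>

definition deflate :: "'a :: ring_1 mat \<Rightarrow> 'a mat" where
  "deflate A = mat (dim_row A - 1) (dim_col A - 1)
     (\<lambda>(i, j). A $$ (Suc i, Suc j) - A $$ (0, Suc j))"

text \<open>Formulated over an arbitrary ring so that it covers the real matrix as well as its
  complex image, whose characteristic polynomial has to be factored.\<close>

definition unit_row_sums :: "nat \<Rightarrow> 'a :: ring_1 mat \<Rightarrow> bool" where
  "unit_row_sums n A \<longleftrightarrow> A \<in> carrier_mat n n \<and> (\<forall>i<n. (\<Sum>j<n. A $$ (i, j)) = 1)"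

lemma deflate_carrier [simp]: "A \<in> carrier_mat (Suc m) (Suc m) \<Longrightarrow> deflate A \<in> carrier_mat m m"
  by (auto simp: deflate_def)

lemma deflate_index:
  "A \<in> carrier_mat (Suc m) (Suc m) \<Longrightarrow> i < m \<Longrightarrow> j < m \<Longrightarrow>
   deflate A $$ (i, j) = A $$ (Suc i, Suc j) - A $$ (0, Suc j)"
  by (auto simp: deflate_def)

lemma index_mult_mat_sum:
  "A \<in> carrier_mat n m \<Longrightarrow> B \<in> carrier_mat m p \<Longrightarrow> i < n \<Longrightarrow> j < p \<Longrightarrow>
   (A * B) $$ (i, j) = (\<Sum>l<m. A $$ (i, l) * B $$ (l, j))"
  by (auto simp: scalar_prod_def lessThan_atLeast0 intro!: sum.cong)

lemma unit_row_sums_mult: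
  assumes A: "unit_row_sums n A" and B: "unit_row_sums n B"
  shows "unit_row_sums n (A * B)"
proof -
  have c: "A \<in> carrier_mat n n" "B \<in> carrier_mat n n"
    using A B by (auto simp: unit_row_sums_def)
  have "(\<Sum>j<n. (A * B) $$ (i, j)) = 1" if i: "i < n" for i
  proof -
    have "(\<Sum>j<n. (A * B) $$ (i, j)) = (\<Sum>j<n. \<Sum>l<n. A $$ (i, l) * B $$ (l, j))"
      using c i by (intro sum.cong refl index_mult_mat_sum) auto
    also have "\<dots> = (\<Sum>l<n. A $$ (i, l) * (\<Sum>j<n. B $$ (l, j)))"
      by (subst sum.swap) (simp add: sum_distrib_left)
    also have "\<dots> = (\<Sum>l<n. A $$ (i, l))"
      using B by (intro sum.cong) (auto simp: unit_row_sums_def)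
    finally show ?thesis using A i by (simp add: unit_row_sums_def)
  qed
  then show ?thesis using c by (auto simp: unit_row_sums_def)
qed

lemma unit_row_sums_one: "unit_row_sums n (1\<^sub>m n)"
  by (auto simp: unit_row_sums_def)

lemma unit_row_sums_pow: "unit_row_sums n A \<Longrightarrow> unit_row_sums n (A ^\<^sub>m k)"
proof (induction k)
  case 0
  then have "dim_row A = n" by (auto simp: unit_row_sums_def)
  then show ?case by (simp add: unit_row_sums_one)
qed (auto intro: unit_row_sums_mult)

text \<open>The difference of two rows of \<open>A\<close> sums to 0, so pairing it with a column of
  \<open>B\<close> gives the same value after a constant is subtracted from that column. Taking the
  entry in row 0 as the constant turns the column into one of \<open>deflate B\<close>.\<close>

lemma deflate_mult:
  assumes A: "unit_row_sums (Suc m) A" and B: "B \<in> carrier_mat (Suc m) (Suc m)"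
  shows "deflate (A * B) = deflate A * deflate B"
proof (rule eq_matI)
  have c: "A \<in> carrier_mat (Suc m) (Suc m)"
    using A by (auto simp: unit_row_sums_def)
  have cAB: "A * B \<in> carrier_mat (Suc m) (Suc m)" using c B by simp
  fix i j assume "i < dim_row (deflate A * deflate B)" "j < dim_col (deflate A * deflate B)"
  then have i: "i < m" and j: "j < m" using c B by (auto simp: deflate_def)
  let ?d = "\<lambda>l. A $$ (Suc i, l) - A $$ (0, l)"
  have zero: "(\<Sum>l<Suc m. ?d l) = 0"
    using A i by (simp only: sum_subtractf) (simp add: unit_row_sums_def del: sum.lessThan_Suc)
  have "deflate (A * B) $$ (i, j) = (\<Sum>l<Suc m. ?d l * B $$ (l, Suc j))"
    using i j c B cAB
    by (simp add: deflate_index[OF cAB] index_mult_mat_sum[OF c B] sum_subtractf left_diff_distrib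
             del: sum.lessThan_Suc index_mult_mat)
  also have "\<dots> = (\<Sum>l<Suc m. ?d l * B $$ (l, Suc j)) - (\<Sum>l<Suc m. ?d l) * B $$ (0, Suc j)"
    by (simp only: zero) simp
  also have "\<dots> = (\<Sum>l<Suc m. ?d l * (B $$ (l, Suc j) - B $$ (0, Suc j)))"
    unfolding sum_distrib_right sum_subtractf[symmetric]
    by (intro sum.cong) (auto simp: algebra_simps)
  \<comment> \<open>The term for \<open>l = 0\<close> vanishes, since there row 0 of
    \<open>B\<close> is subtracted from itself.\<close>
  also have "\<dots> = (\<Sum>l<m. ?d (Suc l) * (B $$ (Suc l, Suc j) - B $$ (0, Suc j)))"
    by (subst sum.lessThan_Suc_shift) simp
  also have "\<dots> = (deflate A * deflate B) $$ (i, j)"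
    using i j by (subst index_mult_mat_sum[of _ m m _ m])
       (auto simp: deflate_index[OF c] deflate_index[OF B] c B)
  finally show "deflate (A * B) $$ (i, j) = (deflate A * deflate B) $$ (i, j)" .
qed (use assms in \<open>auto simp: deflate_def unit_row_sums_def\<close>)

lemma deflate_one: "deflate (1\<^sub>m (Suc m)) = 1\<^sub>m m"
  by (rule eq_matI) (auto simp: deflate_def)

lemma deflate_pow:
  assumes A: "unit_row_sums (Suc m) A"
  shows "deflate (A ^\<^sub>m k) = deflate A ^\<^sub>m k"
proof (induction k)
  case 0
  have "A \<in> carrier_mat (Suc m) (Suc m)" using A by (simp add: unit_row_sums_def)
  then show ?case by (auto simp: deflate_one deflate_def)
next
  case (Suc k)
  then show ?case using A unit_row_sums_pow[OF A, of k]
    by (simp add: deflate_mult[of m] unit_row_sums_def)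
qed

text \<open>Conjugation by the matrix whose columns are the all-ones vector and the last
  \<open>m\<close> unit vectors splits off the eigenvalue 1.\<close>

lemma char_poly_deflate:
  fixes A :: "'a :: comm_ring_1 mat"
  assumes A: "unit_row_sums (Suc m) A"
  shows "char_poly A = [:-1, 1:] * char_poly (deflate A)"
proof -
  let ?n = "Suc m"
  define P :: "'a mat" where "P = mat ?n ?n (\<lambda>(i, j). if j = 0 \<or> i = j then 1 else 0)"
  define Q :: "'a mat"
    where "Q = mat ?n ?n (\<lambda>(i, j). if i = j then 1 else if j = 0 then - 1 else 0)"
  define R :: "'a mat" where "R = mat 1 m (\<lambda>(i, j). A $$ (0, Suc j))"
  \<comment> \<open>The block form of \<open>Q * A * P\<close>, where \<open>Q\<close> is the
    inverse of \<open>P\<close>. As \<open>A\<close> fixes the all-ones vector, column 0 becomes the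
    first unit vector; \<open>Q\<close> subtracts row 0 from all other rows, which leaves
    \<open>deflate A\<close> in the lower right block.\<close>
  define B where "B = four_block_mat (1\<^sub>m 1) R (0\<^sub>m m 1) (deflate A)"
  have cA: "A \<in> carrier_mat ?n ?n" using A by (simp add: unit_row_sums_def)
  have cP: "P \<in> carrier_mat ?n ?n" and cQ: "Q \<in> carrier_mat ?n ?n"
    and cR: "R \<in> carrier_mat 1 m"
    by (auto simp: P_def Q_def R_def)
  have cB: "B \<in> carrier_mat ?n ?n"
    unfolding B_def using cA by (metis deflate_carrier four_block_carrier_mat one_carrier_mat plus_1_eq_Suc)
  have Q_mult: "(Q * X) $$ (i, j) = X $$ (i, j) - (if i = 0 then 0 else X $$ (0, j))"
    if X: "X \<in> carrier_mat ?n ?n" and i: "i < ?n" and j: "j < ?n" for X i j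
  proof -
    have "(Q * X) $$ (i, j) = (\<Sum>l<?n. Q $$ (i, l) * X $$ (l, j))"
      by (rule index_mult_mat_sum[OF cQ X i j])
    also have "\<dots> = (\<Sum>l<?n. (if l = i then X $$ (l, j) else 0)
                          - (if l = 0 then if i = 0 then 0 else X $$ (0, j) else 0))"
      using i by (intro sum.cong) (auto simp: Q_def)
    also have "\<dots> = X $$ (i, j) - (if i = 0 then 0 else X $$ (0, j))"
      using i by (simp only: sum_subtractf) (simp del: sum.lessThan_Suc)
    finally show ?thesis .
  qed
  have mult_P: "(X * P) $$ (i, j) = (if j = 0 then \<Sum>l<?n. X $$ (i, l) else X $$ (i, j))"
    if X: "X \<in> carrier_mat ?n ?n" and i: "i < ?n" and j: "j < ?n" for X i j
  proof -
    have "(X * P) $$ (i, j) = (\<Sum>l<?n. X $$ (i, l) * P $$ (l, j))"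
      by (rule index_mult_mat_sum[OF X cP i j])
    also have "\<dots> = (\<Sum>l<?n. if j = 0 then X $$ (i, l) else if l = j then X $$ (i, l) else 0)"
      using j by (intro sum.cong) (auto simp: P_def)
    also have "\<dots> = (if j = 0 then \<Sum>l<?n. X $$ (i, l) else X $$ (i, j))"
      using j by (cases "j = 0") (simp_all del: sum.lessThan_Suc)
    finally show ?thesis .
  qed
  have QP: "Q * P = 1\<^sub>m ?n"
  proof (rule eq_matI)
    fix i j assume "i < dim_row (1\<^sub>m ?n)" "j < dim_col (1\<^sub>m ?n)"
    then have ij: "i < ?n" "j < ?n" by auto
    then show "(Q * P) $$ (i, j) = 1\<^sub>m ?n $$ (i, j)"
      by (subst Q_mult[OF cP ij]) (auto simp: P_def)
  qed (use cP cQ in auto)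
  have PQ: "P * Q = 1\<^sub>m ?n"
  proof (rule eq_matI)
    fix i j assume "i < dim_row (1\<^sub>m ?n)" "j < dim_col (1\<^sub>m ?n)"
    then have ij: "i < ?n" "j < ?n" by auto
    have "(P * Q) $$ (i, j) = (\<Sum>l<?n. P $$ (i, l) * Q $$ (l, j))"
      by (rule index_mult_mat_sum[OF cP cQ ij])
    also have "\<dots> = Q $$ (0, j) + (\<Sum>l<m. P $$ (i, Suc l) * Q $$ (Suc l, j))"
      using ij by (subst sum.lessThan_Suc_shift) (simp add: P_def)
    also have "(\<Sum>l<m. P $$ (i, Suc l) * Q $$ (Suc l, j)) =
               (\<Sum>l<m. if Suc l = i then Q $$ (i, j) else 0)"
      using ij by (intro sum.cong) (auto simp: P_def)
    also have "\<dots> = (if i = 0 then 0 else Q $$ (i, j))"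
      using ij by (cases i) auto
    finally show "(P * Q) $$ (i, j) = 1\<^sub>m ?n $$ (i, j)"
      using ij by (auto simp: Q_def)
  qed (use cP cQ in auto)
  have "B = Q * A * P"
  proof (rule eq_matI)
    fix i j assume "i < dim_row (Q * A * P)" "j < dim_col (Q * A * P)"
    then have ij: "i < ?n" "j < ?n" using cQ cP by auto
    have QA: "Q * A \<in> carrier_mat ?n ?n" using cQ cA by simp
    have sums: "(\<Sum>l<?n. A $$ (i, l)) = 1" "(\<Sum>l<?n. A $$ (0, l)) = 1"
      using A ij unfolding unit_row_sums_def by blast+
    have dims: "dim_row (deflate A) = m" "dim_col (deflate A) = m"
      using cA by (auto simp: deflate_def)
    have "(\<Sum>l<?n. (Q * A) $$ (i, l)) = (\<Sum>l<?n. A $$ (i, l) - (if i = 0 then 0 else A $$ (0, l)))"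
      using ij by (intro sum.cong refl Q_mult[OF cA]) auto
    also have "\<dots> = (if i = 0 then 1 else 0)"
      using sums by (simp add: sum_subtractf del: sum.lessThan_Suc)
    finally have s: "(\<Sum>l<?n. (Q * A) $$ (i, l)) = (if i = 0 then 1 else 0)" .
    have "(Q * A * P) $$ (i, j) = (if j = 0 then if i = 0 then 1 else 0
              else A $$ (i, j) - (if i = 0 then 0 else A $$ (0, j)))"
      unfolding mult_P[OF QA ij] s Q_mult[OF cA ij] ..
    also have "\<dots> = B $$ (i, j)"
      using ij dims cA unfolding B_def
      by (cases i; cases j) (auto simp: R_def deflate_index)
    finally show "B $$ (i, j) = (Q * A * P) $$ (i, j)" ..
  qed (use cB cQ cP in auto)
  then have "similar_mat B A"
    using cA cB cP cQ PQ QP by (intro similar_matI[of _ _ Q P ?n]) auto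
  then have "char_poly A = char_poly B" by (simp add: char_poly_similar)
  also have "\<dots> = char_poly (1\<^sub>m 1 :: 'a mat) * char_poly (deflate A)"
    unfolding B_def using cA cR by (intro char_poly_four_block_zeros_col) auto
  also have "char_poly (1\<^sub>m 1 :: 'a mat) = [:-1, 1:]"
    by (subst char_poly_upper_triangular[of _ 1]) (auto simp: diag_mat_def)
  finally show ?thesis .
qed

section \<open>The coefficient of ergodicity\<close>

text \<open>The positive and negative parts of \<open>d\<close> have the same mass, namely half of
  the sum of the absolute values, so the sum is that mass times an average of differences of
  \<open>w\<close>. It is applied with \<open>d\<close> a difference of two rows; \<open>w\<close>
  is complex because eigenvectors may be.\<close>

lemma norm_sum_zero_weights_le:
  fixes d :: "nat \<Rightarrow> real" and w :: "nat \<Rightarrow> complex"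
  assumes zero: "(\<Sum>j<n. d j) = 0" and M: "\<And>j l. j < n \<Longrightarrow> l < n \<Longrightarrow> cmod (w j - w l) \<le> M"
  shows "cmod (\<Sum>j<n. of_real (d j) * w j) \<le> (1 / 2 * (\<Sum>j<n. \<bar>d j\<bar>)) * M"
proof -
  define p where "p j = max (d j) 0" for j
  define m where "m j = max (- d j) 0" for j
  define s where "s = (\<Sum>j<n. p j)"
  have pm: "d j = p j - m j" "\<bar>d j\<bar> = p j + m j" "p j \<ge> 0" "m j \<ge> 0" for j
    by (auto simp: p_def m_def)
  have m: "(\<Sum>j<n. m j) = s" using zero by (simp add: pm(1) s_def sum_subtractf)
  then have s: "1 / 2 * (\<Sum>j<n. \<bar>d j\<bar>) = s" by (simp add: pm(2) s_def sum.distrib)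
  have s0: "s \<ge> 0" by (simp add: s_def pm sum_nonneg)
  show ?thesis
  \<comment> \<open>The coupling determines the sum only after division by \<open>s\<close>; for
    \<open>s = 0\<close> all weights are 0.\<close>
  proof (cases "s = 0")
    case True
    then have "(\<Sum>j<n. \<bar>d j\<bar>) = 0" using s by simp
    then have "\<forall>j<n. d j = 0"
      using sum_nonneg_eq_0_iff[of "{..<n}" "\<lambda>j. \<bar>d j\<bar>"] by auto
    then show ?thesis using s True by simp
  next
    case False
    \<comment> \<open>\<open>p\<close> and \<open>m\<close> have equal mass, so they can be coupled by the product measure.\<close>
    have "of_real s * (\<Sum>j<n. of_real (d j) * w j) =
        (\<Sum>j<n. \<Sum>l<n. of_real (p j * m l) * (w j - w l))"
    proof -
      have "(\<Sum>j<n. \<Sum>l<n. of_real (p j * m l) * (w j - w l)) =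
         (\<Sum>j<n. of_real (p j) * w j) * (\<Sum>l<n. of_real (m l)) -
         (\<Sum>j<n. of_real (p j)) * (\<Sum>l<n. of_real (m l) * w l)"
        unfolding sum_product sum_subtractf[symmetric]
        by (intro sum.cong) (auto simp: algebra_simps)
      also have "\<dots> = of_real s * (\<Sum>j<n. of_real (d j) * w j)"
        by (simp flip: of_real_sum add: m)
           (simp add: s_def[symmetric] pm(1) algebra_simps sum_subtractf)
      finally show ?thesis ..
    qed
    then have "s * cmod (\<Sum>j<n. of_real (d j) * w j) =
        cmod (\<Sum>j<n. \<Sum>l<n. of_real (p j * m l) * (w j - w l))"
      using s0 by (metis abs_of_nonneg norm_mult norm_of_real)
    also have "\<dots> \<le> (\<Sum>j<n. \<Sum>l<n. (p j * m l) * M)"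
      by (intro sum_norm_le order.trans[OF norm_sum])
         (auto simp: norm_mult pm intro!: mult_left_mono M)
    also have "\<dots> = s * (s * M)"
      by (simp add: m s_def[symmetric] flip: sum_distrib_left sum_distrib_right)
    finally show ?thesis using False s0 s by simp
  qed
qed

lemma q_bdd_above:
  fixes B :: "real mat"
  shows "bdd_above ((\<lambda>(i, k). \<Sum>j<dim_col B. \<bar>B $$ (i, j) - B $$ (k, j)\<bar>) `
     ({..<dim_row B} \<times> {..<dim_row B}))"
  by simp

lemma half_row_dist_le_q:
  assumes B: "B \<in> carrier_mat n n'" and ik: "i < n" "k < n"
  shows "1 / 2 * (\<Sum>j<n'. \<bar>B $$ (i, j) - B $$ (k, j)\<bar>) \<le> q B"
  using cSUP_upper[OF _ q_bdd_above, of "(i, k)" B] assms by (auto simp: q_def)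

lemma q_le:
  assumes B: "B \<in> carrier_mat n n'" "n > 0"
    and b: "\<And>i k. i < n \<Longrightarrow> k < n \<Longrightarrow> 1 / 2 * (\<Sum>j<n'. \<bar>B $$ (i, j) - B $$ (k, j)\<bar>) \<le> b"
  shows "q B \<le> b"
proof -
  have "(SUP (i, k) \<in> {..<dim_row B} \<times> {..<dim_row B}.
           \<Sum>j<dim_col B. \<bar>B $$ (i, j) - B $$ (k, j)\<bar>) \<le> 2 * b"
    using B b by (intro cSUP_least) (auto simp: lessThan_empty_iff mult.commute[of 2])
  then show ?thesis by (simp add: q_def)
qed

text \<open>An eigenvector of the deflated matrix, padded by a zero entry, is multiplied by \<open>\<mu>\<close>
  up to a multiple of the all-ones vector, and \<open>q\<close> bounds the contraction of the oscillation.\<close>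

lemma eigenvalue_deflate_le_q:
  assumes A: "unit_row_sums (Suc m) A"
    and ev: "eigenvalue (map_mat complex_of_real (deflate A)) \<mu>"
  shows "cmod \<mu> \<le> q A"
proof -
  let ?n = "Suc m" and ?C = "map_mat complex_of_real (deflate A)"
  have cA: "A \<in> carrier_mat ?n ?n" using A by (simp add: unit_row_sums_def)
  then have cC: "?C \<in> carrier_mat m m" by simp
  obtain v where v: "v \<in> carrier_vec m" "v \<noteq> 0\<^sub>v m" "?C *\<^sub>v v = \<mu> \<cdot>\<^sub>v v"
    using ev cC unfolding eigenvalue_def eigenvector_def by auto
  define w where "w i = (case i of 0 \<Rightarrow> 0 | Suc i \<Rightarrow> v $ i)" for i
  \<comment> \<open>The multiple of the all-ones vector that is split off is entry 0 of
    \<open>A\<close> applied to \<open>w\<close>. For \<open>i = 0\<close> both sides are 0 because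
    of the padding.\<close>
  have base: "(\<Sum>j<?n. of_real (A $$ (i, j) - A $$ (0, j)) * w j) = \<mu> * w i" if i: "i < ?n" for i
  proof (cases i)
    case (Suc i')
    then have i': "i' < m" using i by simp
    have "\<mu> * w i = (?C *\<^sub>v v) $ i'" using v i' Suc by (simp add: w_def)
    also have "\<dots> = (\<Sum>j<m. ?C $$ (i', j) * v $ j)"
      using cC v(1) i' by (auto simp: scalar_prod_def lessThan_atLeast0 intro!: sum.cong)
    also have "\<dots> = (\<Sum>j<m. of_real (A $$ (i, Suc j) - A $$ (0, Suc j)) * w (Suc j))"
      using i' Suc carrier_matD[OF deflate_carrier[OF cA]]
      by (intro sum.cong) (auto simp: w_def deflate_index[OF cA])
    finally show ?thesis by (subst sum.lessThan_Suc_shift) (simp add: w_def)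
  qed (simp add: w_def)
  \<comment> \<open>Subtracting two instances of \<open>base\<close> removes row 0 and the multiple
    of the all-ones vector.\<close>
  have diff: "(\<Sum>j<?n. of_real (A $$ (i, j) - A $$ (k, j)) * w j) = \<mu> * (w i - w k)"
    if "i < ?n" "k < ?n" for i k
  proof -
    have "(\<Sum>j<?n. of_real (A $$ (i, j) - A $$ (k, j)) * w j) =
        (\<Sum>j<?n. of_real (A $$ (i, j) - A $$ (0, j)) * w j)
        - (\<Sum>j<?n. of_real (A $$ (k, j) - A $$ (0, j)) * w j)"
      unfolding sum_subtractf[symmetric] by (intro sum.cong) (auto simp: algebra_simps)
    then show ?thesis unfolding base[OF that(1)] base[OF that(2)] by (simp add: right_diff_distrib)
  qed
  \<comment> \<open>\<open>Max S\<close> is the oscillation of \<open>w\<close>. Estimating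
    \<open>diff\<close> at a pair that attains it bounds \<open>\<mu>\<close> times the oscillation
    by \<open>q A\<close> times the oscillation.\<close>
  define S where "S = (\<lambda>(i, k). cmod (w i - w k)) ` ({..<?n} \<times> {..<?n})"
  have S: "finite S" "S \<noteq> {}" by (auto simp: S_def)
  obtain i k where ik: "i < ?n" "k < ?n" "Max S = cmod (w i - w k)"
    using Max_in[OF S] unfolding S_def by auto
  have M: "cmod (w j - w l) \<le> Max S" if "j < ?n" "l < ?n" for j l
    using S that by (intro Max_ge) (auto simp: S_def)
  obtain i' where i': "i' < m" "v $ i' \<noteq> 0" using v(1,2) by (metis eq_vecI carrier_vecD index_zero_vec)
  \<comment> \<open>The oscillation can be cancelled: the eigenvector has a nonzero entry, which
    differs from the padding entry 0.\<close>
  have pos: "Max S > 0"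
    using M[of "Suc i'" 0] i' by (simp add: w_def) (meson less_le_trans zero_less_norm_iff)
  have "(\<Sum>j<?n. A $$ (i, j) - A $$ (k, j)) = 0"
    using A ik by (simp add: unit_row_sums_def sum_subtractf del: sum.lessThan_Suc)
  then have "cmod (\<mu> * (w i - w k)) \<le> (1 / 2 * (\<Sum>j<?n. \<bar>A $$ (i, j) - A $$ (k, j)\<bar>)) * Max S"
    unfolding diff[OF ik(1,2), symmetric] using M by (rule norm_sum_zero_weights_le)
  also have "\<dots> \<le> q A * Max S"
    using half_row_dist_le_q[OF cA ik(1,2)] pos by (intro mult_right_mono) auto
  finally show ?thesis using ik pos by (simp add: norm_mult)
qed

text \<open>Differences to row 0 sum to 0, so the entry in the deleted column 0 is at most the total
  of the others in absolute value. Each row is thus within \<open>2 * real m * b\<close> of row 0;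
  the triangle inequality doubles this and the factor 1/2 in \<open>q\<close> halves it
  again.\<close>

lemma q_le_deflate:
  assumes A: "unit_row_sums (Suc m) A"
    and b: "\<And>i j. i < m \<Longrightarrow> j < m \<Longrightarrow> \<bar>deflate A $$ (i, j)\<bar> \<le> b"
  shows "q A \<le> 2 * real m * b"
proof -
  let ?n = "Suc m"
  have cA: "A \<in> carrier_mat ?n ?n" using A by (simp add: unit_row_sums_def)
  have base: "(\<Sum>j<?n. \<bar>A $$ (i, j) - A $$ (0, j)\<bar>) \<le> 2 * real m * b" if i: "i < ?n" for i
  proof (cases i)
    case 0
    have "0 \<le> real m * b"
    \<comment> \<open>For \<open>m = 0\<close> nothing prevents \<open>b\<close> from being
      negative, but then the product is 0.\<close>
    proof (cases "m = 0")
      case False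
      then have "0 \<le> b" using b[of 0 0] abs_ge_zero order_trans by blast
      then show ?thesis by simp
    qed simp
    then show ?thesis using 0 by (simp add: mult.commute)
  next
    case (Suc i')
    let ?d = "\<lambda>j. A $$ (i, j) - A $$ (0, j)"
    have "(\<Sum>j<?n. ?d j) = 0"
      using A i by (simp add: unit_row_sums_def sum_subtractf del: sum.lessThan_Suc)
    then have "?d 0 + (\<Sum>j<m. ?d (Suc j)) = 0" by (subst (asm) sum.lessThan_Suc_shift)
    then have "\<bar>?d 0\<bar> = \<bar>\<Sum>j<m. ?d (Suc j)\<bar>" by linarith
    then have "\<bar>?d 0\<bar> \<le> (\<Sum>j<m. \<bar>?d (Suc j)\<bar>)" using sum_abs by metis
    moreover have "(\<Sum>j<m. \<bar>?d (Suc j)\<bar>) \<le> (\<Sum>j<m. b)"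
      using b[of i'] Suc i by (intro sum_mono) (auto simp: deflate_index[OF cA])
    ultimately show ?thesis by (subst sum.lessThan_Suc_shift) simp
  qed
  show ?thesis
  proof (rule q_le[OF cA])
    fix i k assume ik: "i < ?n" "k < ?n"
    have "(\<Sum>j<?n. \<bar>A $$ (i, j) - A $$ (k, j)\<bar>) \<le>
          (\<Sum>j<?n. \<bar>A $$ (i, j) - A $$ (0, j)\<bar> + \<bar>A $$ (k, j) - A $$ (0, j)\<bar>)"
      by (intro sum_mono) linarith
    also have "\<dots> \<le> 2 * real m * b + 2 * real m * b"
      unfolding sum.distrib using base ik by (intro add_mono) auto
    finally show "1 / 2 * (\<Sum>j<?n. \<bar>A $$ (i, j) - A $$ (k, j)\<bar>) \<le> 2 * real m * b" by linarith
  qed simp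
qed

section \<open>Growth of matrix powers\<close>

lemma smult_pow_mat:
  fixes A :: "'a :: comm_ring_1 mat"
  assumes A: "A \<in> carrier_mat n n"
  shows "(c \<cdot>\<^sub>m A) ^\<^sub>m k = c ^ k \<cdot>\<^sub>m A ^\<^sub>m k"
proof (induction k)
  case 0
  then show ?case by (intro eq_matI) auto
next
  case (Suc k)
  have "A ^\<^sub>m k \<in> carrier_mat n n" using A by simp
  then show ?case using A Suc
    by (intro eq_matI) (auto simp: ac_simps)
qed

text \<open>Scaling by \<open>1 / r\<close> brings the spectral radius below 1. The powers of the
  scaled matrix are then bounded by the Jordan normal form, and scaling back produces the factor
  \<open>r ^ k\<close>.\<close>

lemma pow_mat_growth:
  fixes C :: "complex mat"
  assumes C: "C \<in> carrier_mat m m" "m > 0" and r: "spectral_radius C < r" "r > 0"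
  obtains c where "\<And>k i j. i < m \<Longrightarrow> j < m \<Longrightarrow> cmod ((C ^\<^sub>m k) $$ (i, j)) \<le> c * r ^ k"
proof -
  let ?D = "of_real (1 / r) \<cdot>\<^sub>m C"
  have D: "?D \<in> carrier_mat m m" using C by simp
  obtain \<mu> where mu: "eigenvalue ?D \<mu>" "spectral_radius ?D = cmod \<mu>"
    using spectral_radius_mem_max(1)[OF D C(2)] by (auto simp: spectrum_def)
  obtain v where v: "v \<in> carrier_vec m" "v \<noteq> 0\<^sub>v m" "?D *\<^sub>v v = \<mu> \<cdot>\<^sub>v v"
    using mu(1) D unfolding eigenvalue_def eigenvector_def by auto
  have "C *\<^sub>v v = of_real r \<cdot>\<^sub>v (?D *\<^sub>v v)"
    using C v(1) r by (intro eq_vecI) auto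
  also have "\<dots> = (of_real r * \<mu>) \<cdot>\<^sub>v v" unfolding v(3) by (rule smult_smult_assoc)
  finally have "eigenvalue C (of_real r * \<mu>)"
    using v(1,2) C unfolding eigenvalue_def eigenvector_def by auto
  then have "cmod (of_real r * \<mu>) \<le> spectral_radius C"
    by (intro spectral_radius_mem_max(2)[OF C]) (simp add: spectrum_def)
  then have "r * cmod \<mu> \<le> spectral_radius C" using r(2) by (simp add: norm_mult)
  then have "r * cmod \<mu> < r * 1" using r(1) by linarith
  then have "spectral_radius ?D < 1" using r(2) mu(2) mult_less_cancel_left_pos by metis
  then obtain c where c: "\<And>k. norm_bound (?D ^\<^sub>m k) c"
    using spectral_radius_jnf_norm_bound_less_1_upper_triangular[OF D] by blast
  show thesis
  proof
    fix k i j assume ij: "i < m" "j < m"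
    have "cmod ((?D ^\<^sub>m k) $$ (i, j)) \<le> c"
      using c[of k] ij carrier_matD[OF pow_carrier_mat[OF D, of k]]
      unfolding norm_bound_def by metis
    moreover have "cmod ((?D ^\<^sub>m k) $$ (i, j)) = cmod ((C ^\<^sub>m k) $$ (i, j)) / r ^ k"
      using ij C r by (simp add: smult_pow_mat[OF C(1)] norm_mult norm_power norm_divide power_one_over)
    ultimately have "cmod ((C ^\<^sub>m k) $$ (i, j)) / r ^ k \<le> c" by argo
    then show "cmod ((C ^\<^sub>m k) $$ (i, j)) \<le> c * r ^ k"
      using r(2) by (simp add: pos_divide_le_eq)
  qed
qed

section \<open>Limit and infimum of the roots in terms of the second eigenvalue\<close>

theorem theorem1:
  fixes n :: nat and A :: "real mat" and es :: "complex list"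
  assumes "n \<ge> 2"
    and "row_stochastic n A"
    and "eigenvalue_list A es"
    and "es ! 0 = 1"
    and "sorted_wrt (\<lambda>x y. cmod x \<ge> cmod y) es"
  shows "(\<lambda>k. root k (q (A ^\<^sub>m k))) \<longlonglongrightarrow> cmod (es ! 1) \<and>
         cmod (es ! 1) = (INF k\<in>{1..}. root k (q (A ^\<^sub>m k)))"
proof -
  obtain m where m: "n = Suc m" "m > 0" using assms(1) by (cases n) auto
  let ?A = "map_mat complex_of_real A"
  define C where "C = map_mat complex_of_real (deflate A)"
  have A: "unit_row_sums (Suc m) A"
    using assms(2) m by (auto simp: row_stochastic_def unit_row_sums_def)
  then have cA: "A \<in> carrier_mat (Suc m) (Suc m)" by (simp add: unit_row_sums_def)
  have cC: "C \<in> carrier_mat m m" using cA by (simp add: C_def)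
  have uA: "unit_row_sums (Suc m) ?A"
    using A by (auto simp: unit_row_sums_def simp flip: of_real_sum simp del: sum.lessThan_Suc)
  have "deflate ?A = C"
    using cA by (intro eq_matI) (auto simp: C_def deflate_def)
  then have cp: "(\<Prod>a\<leftarrow>es. [:- a, 1:]) = [:-1, 1:] * char_poly C"
    using assms(3) char_poly_deflate[OF uA] by (simp add: eigenvalue_list_def)
  have "es \<noteq> []"
  proof
    assume "es = []"
    then have "[:-1, 1:] * char_poly C = 1" using cp by simp
    \<comment> \<open>Evaluation at 1, a root of the left-hand side, gives the
      contradiction.\<close>
    then have "poly ([:-1, 1:] * char_poly C) 1 = 1" by simp
    then show False by simp
  qed
  then obtain es' where es: "es = 1 # es'" using assms(4) by (cases es) auto
  then have "[:-1, 1:] * char_poly C = [:-1, 1:] * (\<Prod>a\<leftarrow>es'. [:- a, 1:])" using cp by simp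
  \<comment> \<open>Cancelling the common linear factor shows that the list without its head
    consists of the eigenvalues of \<open>C\<close> with multiplicity.\<close>
  then have cpC: "char_poly C = (\<Prod>a\<leftarrow>es'. [:- a, 1:])"
    by (subst (asm) mult_left_cancel) auto
  have "es' \<noteq> []" using degree_monic_char_poly[OF cC] m cpC by auto
  then obtain \<mu> es'' where es': "es' = \<mu> # es''" by (cases es') auto
  have ev_iff: "eigenvalue C x \<longleftrightarrow> x \<in> set es'" for x
    unfolding eigenvalue_root_char_poly[OF cC] cpC by (induction es') auto
  define \<rho> where "\<rho> = cmod \<mu>"
  have rho: "cmod (es ! 1) = \<rho>" "\<rho> \<ge> 0" by (auto simp: \<rho>_def es es')
  have evC: "eigenvalue C \<mu>" using ev_iff es' by simp
  \<comment> \<open>By the ordering, the head \<open>\<mu>\<close> of \<open>es'\<close> has the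
    largest modulus among the eigenvalues of \<open>C\<close>.\<close>
  have sr: "spectral_radius C \<le> \<rho>"
  proof -
    obtain x where "x \<in> set es'" "spectral_radius C = cmod x"
      using spectral_radius_mem_max(1)[OF cC m(2)] ev_iff by (auto simp: spectrum_def)
    then show ?thesis using assms(5) by (auto simp: es es' \<rho>_def)
  qed
  have C_pow: "map_mat complex_of_real (deflate (A ^\<^sub>m k)) = C ^\<^sub>m k" for k
    unfolding deflate_pow[OF A] C_def
    by (rule of_real_hom.mat_hom_pow[OF deflate_carrier[OF cA]])
  \<comment> \<open>\<open>\<mu> ^ k\<close> is an eigenvalue of \<open>C ^\<^sub>m k\<close>, the
    deflation of \<open>A ^\<^sub>m k\<close>, so the contraction bound applies to that power
    itself.\<close>
  have q_ge: "\<rho> ^ k \<le> q (A ^\<^sub>m k)" for k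
  proof -
    obtain v where "eigenvector C v \<mu>" using evC by (auto simp: eigenvalue_def)
    moreover from this have "C ^\<^sub>m k *\<^sub>v v = \<mu> ^ k \<cdot>\<^sub>v v" by (rule eigenvector_pow[OF cC])
    ultimately have "eigenvalue (C ^\<^sub>m k) (\<mu> ^ k)"
      using cC unfolding eigenvalue_def eigenvector_def by auto
    then show ?thesis
      using eigenvalue_deflate_le_q[OF unit_row_sums_pow[OF A]]
      unfolding C_pow[symmetric] \<rho>_def norm_power[symmetric] by blast
  qed
  have root_ge: "\<rho> \<le> root k (q (A ^\<^sub>m k))" if "k \<ge> 1" for k
    using real_root_le_mono[OF _ q_ge[of k], of k] rho(2) that by (simp add: real_root_power_cancel)
  have lim: "(\<lambda>k. root k (q (A ^\<^sub>m k))) \<longlonglongrightarrow> \<rho>"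
  proof (rule order_tendstoI)
    fix y assume "y < \<rho>"
    then show "\<forall>\<^sub>F k in sequentially. y < root k (q (A ^\<^sub>m k))"
      \<comment> \<open>The bound starts at index 1, since \<open>root 0\<close> is 0 by
        convention.\<close>
      using root_ge by (intro eventually_sequentiallyI[of 1]) (meson less_le_trans)
  next
    fix y assume y: "\<rho> < y"
    \<comment> \<open>The midpoint lies strictly above the spectral radius, as the growth bound
      requires, and strictly below \<open>y\<close>, which leaves room for the factor
      \<open>root k K\<close>.\<close>
    define r where "r = (\<rho> + y) / 2"
    have r: "\<rho> < r" "r < y" "r > 0" using y rho(2) by (auto simp: r_def)
    obtain c where c: "\<And>k i j. i < m \<Longrightarrow> j < m \<Longrightarrow> cmod ((C ^\<^sub>m k) $$ (i, j)) \<le> c * r ^ k"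
      using pow_mat_growth[OF cC m(2) _ r(3)] sr r(1) by (metis le_less_trans)
    \<comment> \<open>The maximum with 1 makes the constant positive, so that its
      \<open>k\<close>-th roots tend to 1.\<close>
    define K where "K = max 1 (2 * real m * c)"
    have qK: "q (A ^\<^sub>m k) \<le> K * r ^ k" for k
    proof -
      have "\<bar>deflate (A ^\<^sub>m k) $$ (i, j)\<bar> \<le> c * r ^ k" if "i < m" "j < m" for i j
      proof -
        have "(C ^\<^sub>m k) $$ (i, j) = of_real (deflate (A ^\<^sub>m k) $$ (i, j))"
          using that deflate_carrier[OF pow_carrier_mat[OF cA, of k]]
          unfolding C_pow[symmetric] by auto
        then show ?thesis using c[OF that, of k] by simp
      qed
      then have "q (A ^\<^sub>m k) \<le> 2 * real m * (c * r ^ k)"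
        by (rule q_le_deflate[OF unit_row_sums_pow[OF A]])
      also have "\<dots> = (2 * real m * c) * r ^ k" by simp
      also have "\<dots> \<le> K * r ^ k"
        using r(3) by (intro mult_right_mono) (auto simp: K_def)
      finally show ?thesis .
    qed
    have "(\<lambda>k. root k K * r) \<longlonglongrightarrow> 1 * r"
      by (intro tendsto_intros LIMSEQ_root_const) (simp add: K_def)
    then have "\<forall>\<^sub>F k in sequentially. root k K * r < y"
      using r(2) by (intro order_tendstoD(2)[of _ "1 * r"]) auto
    then show "\<forall>\<^sub>F k in sequentially. root k (q (A ^\<^sub>m k)) < y"
      using eventually_ge_at_top[of 1]
    proof eventually_elim
      case (elim k)
      have "root k (q (A ^\<^sub>m k)) \<le> root k (K * r ^ k)" using qK elim by simp
      also have "\<dots> = root k K * r"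
        using elim r(3) by (simp add: real_root_mult real_root_power_cancel)
      finally show ?case using elim by simp
    qed
  qed
  have bdd: "bdd_below ((\<lambda>k. root k (q (A ^\<^sub>m k))) ` {1..})"
    using root_ge by (auto intro!: bdd_belowI[of _ \<rho>])
  \<comment> \<open>The infimum is at most every term and hence at most the limit; the termwise
    bound \<open>root_ge\<close> gives the other inequality.\<close>
  have "(INF k\<in>{1..}. root k (q (A ^\<^sub>m k))) = \<rho>"
  proof (rule antisym)
    show "(INF k\<in>{1..}. root k (q (A ^\<^sub>m k))) \<le> \<rho>"
      using lim by (rule LIMSEQ_le_const) (use cINF_lower[OF bdd] in \<open>auto intro!: exI[of _ 1]\<close>)
    show "\<rho> \<le> (INF k\<in>{1..}. root k (q (A ^\<^sub>m k)))"
      using root_ge by (intro cINF_greatest) auto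
  qed
  then show ?thesis using lim rho(1) by simp
qed

end
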